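(* Let $S_9=(s_0,s_1,\dots,s_{23})$ be the sequence $$(8,8,6,6,4,4,\ 8,8,6,6,4,4,\ 4,4,2,2,0,0,\ 4,4,2,2,0,0).$$ Let $\varphi_9:\mathbb{N}\to\mathbb{N}$ be the function defined as follows. The values $\varphi_9(0),\varphi_9(1),\dots,\varphi_9(63)$ are, in order (ten per row), $$\begin{array}{l}7,6,9,8,11,10,1,0,3,2,\\ 5,4,17,16,23,22,13,12,21,20,\\ 19,18,15,14,31,30,33,32,35,34,\\ 25,24,27,26,29,28,41,40,45,44,\\ 37,36,49,48,39,38,53,52,43,42,\\ 57,56,47,46,61,60,51,50,63,62,\\ 55,54,59,58,\end{array}$$ and for $x\ge 64$, $$\varphi_9(x)=x\oplus_{s_{x-64}}7=\bigl((x+s_{x-64})\oplus 7\bigr)-s_{x-64},$$ where the index $x-64$ is taken modulo $24$. Then, for all nonnegative integers $a,b$, the Halve Nim position $a^1b^19^1$ is a $\mathcal{P}$-position if and only if $b=\varphi_9(a)$.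
   Context: $\mathbb{N}$ is the set of nonnegative integers and $\oplus$ denotes bitwise XOR. The $n$-shifted bitwise sum, for an integer $n$, is $x\oplus_n y=\bigl((x+n)\oplus y\bigr)-n$. Halve Nim is a two-player game played on finitely many piles of coins; players alternate moves and a player who cannot move loses. A move is one of: (i) choose one pile and remove at least one coin from it; (ii) halve the game: simultaneously replace every pile of $m$ coins by a pile of $\lfloor m/2\rfloor$ coins. When there are no coins left, no move is available (halving requires at least one coin to be present). A position is a $\mathcal{P}$-position if the player who is not about to move has a winning strategy (equivalently, every move from it leads to an $\mathcal{N}$-position), and an $\mathcal{N}$-position if the player about to move has a winning strategy. $a^1b^1c^1$ denotes the position with three piles of sizes $a$, $b$, $c$ (a pile of size $0$ is an empty pile); in particular $a^1b^19^1$ has piles of sizes $a$, $b$, $9$. *)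

theory Defs
  imports Main "HOL-Library.Multiset"
begin

text \<open>A position is the multiset of its pile sizes; piles of size 0 may occur.\<close>

type_synonym position = "nat multiset"

inductive move :: "position \<Rightarrow> position \<Rightarrow> bool" where
  remove: "k < m \<Longrightarrow> move (add_mset m G) (add_mset k G)"
| halve: "\<exists>m\<in>#G. 0 < m \<Longrightarrow> move G (image_mset (\<lambda>m. m div 2) G)"

text \<open>
  A strategy tells its owner which position to move to. It wins from \<open>G\<close>, for the player who
  is \<^emph>\<open>not\<close> about to move in \<open>G\<close>, if it has a legal answer to every move of the opponent
  throughout the play and the play is finite, so that the opponent is the one who gets stuck.
\<close>

inductive wins_as_second :: "(position \<Rightarrow> position) \<Rightarrow> position \<Rightarrow> bool"
  for \<sigma> :: "position \<Rightarrow> position" where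
  "(\<And>H. move G H \<Longrightarrow> move H (\<sigma> H) \<and> wins_as_second \<sigma> (\<sigma> H)) \<Longrightarrow> wins_as_second \<sigma> G"

definition P_position :: "position \<Rightarrow> bool" where
  "P_position G \<longleftrightarrow> (\<exists>\<sigma>. wins_as_second \<sigma> G)"

text \<open>The player about to move makes a first move and is then the one not about to move.\<close>

definition N_position :: "position \<Rightarrow> bool" where
  "N_position G \<longleftrightarrow> (\<exists>H. move G H \<and> P_position H)"

lemma sum_mset_halve_le: "sum_mset (image_mset (\<lambda>m. m div 2) G) \<le> sum_mset (G :: nat multiset)"
  by (induction G) auto

lemma sum_mset_move: "move G H \<Longrightarrow> sum_mset H < sum_mset G"
proof (induction rule: move.induct)
  case (remove k m G)
  then show ?case by simp
next
  case (halve G)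
  then obtain m G' where "G = add_mset m G'" "0 < m"
    by (metis insert_DiffM)
  then show ?case
    using sum_mset_halve_le[of G'] by (auto intro: add_less_le_mono)
qed

text \<open>The recursive characterization of P-positions by N-positions.\<close>

lemma P_position_iff: "P_position G \<longleftrightarrow> (\<forall>H. move G H \<longrightarrow> N_position H)"
proof
  assume "P_position G"
  then show "\<forall>H. move G H \<longrightarrow> N_position H"
    unfolding P_position_def N_position_def by (metis wins_as_second.cases)
next
  define \<tau> where "\<tau> H = (SOME K. move H K \<and> P_position K)" for H
  have \<tau>: "move H (\<tau> H) \<and> P_position (\<tau> H)" if "N_position H" for H
    using someI_ex[of "\<lambda>K. move H K \<and> P_position K"] that
    unfolding \<tau>_def N_position_def by blast
  have step: "\<forall>H. move G H \<longrightarrow> N_position H" if "P_position G" for G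
    using that unfolding P_position_def N_position_def by (metis wins_as_second.cases)
  have wins: "wins_as_second \<tau> G" if "\<forall>H. move G H \<longrightarrow> N_position H" for G
    using that
  proof (induction "sum_mset G" arbitrary: G rule: less_induct)
    case less
    show ?case
    proof (rule wins_as_second.intros)
      fix H assume H: "move G H"
      then have *: "move H (\<tau> H)" "P_position (\<tau> H)"
        using \<tau> less.prems by blast+
      have "sum_mset (\<tau> H) < sum_mset G"
        using sum_mset_move[OF H] sum_mset_move[OF *(1)] by simp
      then show "move H (\<tau> H) \<and> wins_as_second \<tau> (\<tau> H)"
        using less.hyps step[OF *(2)] *(1) by blast
    qed
  qed
  assume "\<forall>H. move G H \<longrightarrow> N_position H"
  then show "P_position G"
    using wins P_position_def by blast
qed

lemma N_position_iff: "N_position G \<longleftrightarrow> \<not> P_position G"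
proof (induction "sum_mset G" arbitrary: G rule: less_induct)
  case less
  then show ?case
    using P_position_iff[of G] N_position_def[of G] sum_mset_move[of G] by blast
qed

definition shifted_xor :: "int \<Rightarrow> int \<Rightarrow> int \<Rightarrow> int" where
  "shifted_xor n x y = xor (x + n) y - n"

definition S9 :: "nat list" where
  "S9 = [8,8,6,6,4,4, 8,8,6,6,4,4, 4,4,2,2,0,0, 4,4,2,2,0,0]"

definition phi9_table :: "nat list" where
  "phi9_table =
    [7,6,9,8,11,10,1,0,3,2,
     5,4,17,16,23,22,13,12,21,20,
     19,18,15,14,31,30,33,32,35,34,
     25,24,27,26,29,28,41,40,45,44,
     37,36,49,48,39,38,53,52,43,42,
     57,56,47,46,61,60,51,50,63,62,
     55,54,59,58]"

definition phi9 :: "nat \<Rightarrow> nat" where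
  "phi9 x =
    (if x < 64 then phi9_table ! x
     else nat (shifted_xor (int (S9 ! ((x - 64) mod 24))) (int x) 7))"

text \<open>The conversion to \<^typ>\<open>nat\<close> in the second case never truncates.\<close>

lemma int_phi9:
  assumes "64 \<le> x"
  shows "int (phi9 x) = shifted_xor (int (S9 ! ((x - 64) mod 24))) (int x) 7"
proof -
  have "\<forall>s\<in>set S9. s \<le> 8" by (simp add: S9_def)
  moreover have "length S9 = 24" by (simp add: S9_def)
  ultimately have s: "S9 ! ((x - 64) mod 24) \<le> 8"
    by (simp add: nth_mem)
  define y where "y = int x + int (S9 ! ((x - 64) mod 24))"
  have "drop_bit 3 (xor y 7) = drop_bit 3 y"
    by (simp add: drop_bit_xor)
  then have "xor y 7 div 8 = y div 8"
    by (simp add: drop_bit_eq_div)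
  moreover have "8 \<le> y div 8" using assms unfolding y_def by linarith
  ultimately have "64 \<le> xor y 7" by linarith
  then show ?thesis
    using assms s by (simp add: phi9_def shifted_xor_def y_def)
qed

end

theory Submission
  imports Defs
begin

text \<open>
  For each \<open>c \<le> 9\<close> the P-positions with third pile \<open>c\<close> form the graph of an involution \<open>phi c\<close>.
  A family of involutions has this property as soon as no two of its P-positions are joined by a
  move and every pair \<open>b < phi c a\<close>, \<open>a < phi c b\<close> reaches a P-position by shrinking the third pile
  or by halving; the sum of the piles is the induction measure.

  For \<open>4 \<le> c\<close> the displacement \<open>phi c x - x\<close> is eventually periodic in \<open>x\<close> with period dividing 24.
  For \<open>c < 4\<close> it is not: it alternates between two periodic patterns according to the parity of
  the \<open>k\<close> with \<open>7 * 2 ^ k \<le> x < 7 * 2 ^ (k + 1)\<close>, and halving \<open>x\<close> flips that parity. Carrying the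
  parity along as a boolean makes the conditions invariant under \<open>a \<mapsto> a + 48\<close>, since halving
  turns 48 into the period 24, and only finitely many cases remain.
\<close>

section \<open>Three-pile positions\<close>

lemma P_position_iff_no_move:
  "P_position G \<longleftrightarrow> (\<forall>H. move G H \<longrightarrow> \<not> P_position H)"
  using P_position_iff N_position_iff by blast

lemma move_three_piles_iff:
  "move {#a, b, c#} H \<longleftrightarrow>
     (\<exists>k<a. H = {#k, b, c#}) \<or> (\<exists>k<b. H = {#a, k, c#}) \<or> (\<exists>k<c. H = {#a, b, k#}) \<or>
     (0 < a \<or> 0 < b \<or> 0 < c) \<and> H = {#a div 2, b div 2, c div 2#}"
    (is "?L \<longleftrightarrow> ?R")
proof
  assume ?L
  then show ?R
  proof cases
    case (remove k m G)
    then have "m \<in># {#a, b, c#}" by (metis union_single_eq_member)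
    then consider "m = a" | "m = b" | "m = c" by auto
    then show ?thesis
    proof cases
      case 1
      then have "G = {#b, c#}" using remove by simp
      then show ?thesis using 1 remove by auto
    next
      case 2
      have "add_mset b G = add_mset b {#a, c#}" using 2 remove by (simp add: add_mset_commute)
      then have "G = {#a, c#}" by simp
      then show ?thesis using 2 remove by (auto simp: add_mset_commute)
    next
      case 3
      have "add_mset c G = add_mset c {#a, b#}" using 3 remove by (simp add: add_mset_commute)
      then have "G = {#a, b#}" by simp
      then show ?thesis using 3 remove by (auto simp: add_mset_commute)
    qed
  next
    case halve
    then show ?thesis by auto
  qed
next
  have "move {#a, b, c#} {#k, b, c#}" if "k < a" for k
    using move.remove[OF that, of "{#b, c#}"] .
  moreover have "move {#a, b, c#} {#a, k, c#}" if "k < b" for k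
    using move.remove[OF that, of "{#a, c#}"] by (simp add: add_mset_commute)
  moreover have "move {#a, b, c#} {#a, b, k#}" if "k < c" for k
    using move.remove[OF that, of "{#a, b#}"] by (simp add: add_mset_commute)
  moreover have "move {#a, b, c#} {#a div 2, b div 2, c div 2#}" if "0 < a \<or> 0 < b \<or> 0 < c"
    using move.halve[of "{#a, b, c#}"] that by auto
  moreover assume ?R
  ultimately show ?L by blast
qed

text \<open>The involutions make the claim symmetric in the first two piles, so \<open>mex\<close>
  is demanded only for \<open>a \<le> b\<close>.\<close>

lemma P_position_three_piles_iff:
  fixes f :: "nat \<Rightarrow> nat \<Rightarrow> nat"
  assumes involution: "\<And>c a. c < n \<Longrightarrow> f c (f c a) = a"
    and distinct: "\<And>c k a. c < n \<Longrightarrow> k < c \<Longrightarrow> f k a \<noteq> f c a"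
    and halve: "\<And>c a. c < n \<Longrightarrow> 0 < a \<or> 0 < f c a \<or> 0 < c \<Longrightarrow> f (c div 2) (a div 2) \<noteq> f c a div 2"
    and mex: "\<And>c a b. c < n \<Longrightarrow> a \<le> b \<Longrightarrow> b < f c a \<Longrightarrow> a < f c b \<Longrightarrow>
      (\<exists>k<c. f k a = b) \<or> f (c div 2) (a div 2) = b div 2"
    and "c < n"
  shows "P_position {#a, b, c#} \<longleftrightarrow> b = f c a"
  using \<open>c < n\<close>
proof (induction "a + b + c" arbitrary: a b c rule: less_induct)
  case less
  have c2: "c div 2 < n" using less.prems by linarith
  have "P_position {#a, b, c#} \<longleftrightarrow>
      (\<forall>k<a. \<not> P_position {#k, b, c#}) \<and> (\<forall>k<b. \<not> P_position {#a, k, c#}) \<and>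
      (\<forall>k<c. \<not> P_position {#a, b, k#}) \<and>
      (0 < a \<or> 0 < b \<or> 0 < c \<longrightarrow> \<not> P_position {#a div 2, b div 2, c div 2#})"
    by (subst P_position_iff_no_move) (auto simp: move_three_piles_iff)
  also have "\<dots> \<longleftrightarrow>
      (\<forall>k<a. b \<noteq> f c k) \<and> (\<forall>k<b. k \<noteq> f c a) \<and> (\<forall>k<c. b \<noteq> f k a) \<and>
      (0 < a \<or> 0 < b \<or> 0 < c \<longrightarrow> b div 2 \<noteq> f (c div 2) (a div 2))"
  proof -
    have "P_position {#k, b, c#} \<longleftrightarrow> b = f c k" if "k < a" for k
      using less that by simp
    moreover have "P_position {#a, k, c#} \<longleftrightarrow> k = f c a" if "k < b" for k
      using less that by simp
    moreover have "P_position {#a, b, k#} \<longleftrightarrow> b = f k a" if "k < c" for k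
      using less that by simp
    moreover have "P_position {#a div 2, b div 2, c div 2#} \<longleftrightarrow> b div 2 = f (c div 2) (a div 2)"
      if "0 < a \<or> 0 < b \<or> 0 < c"
    proof -
      have "a div 2 + b div 2 + c div 2 < a + b + c" using that by linarith
      then show ?thesis using less.hyps c2 by blast
    qed
    ultimately show ?thesis by auto
  qed
  also have "\<dots> \<longleftrightarrow> b = f c a"
  proof
    assume "b = f c a"
    then show "(\<forall>k<a. b \<noteq> f c k) \<and> (\<forall>k<b. k \<noteq> f c a) \<and> (\<forall>k<c. b \<noteq> f k a) \<and>
      (0 < a \<or> 0 < b \<or> 0 < c \<longrightarrow> b div 2 \<noteq> f (c div 2) (a div 2))"
      using involution[OF less.prems] distinct[OF less.prems] halve[OF less.prems]
      by (metis nat_neq_iff)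
  next
    assume *: "(\<forall>k<a. b \<noteq> f c k) \<and> (\<forall>k<b. k \<noteq> f c a) \<and> (\<forall>k<c. b \<noteq> f k a) \<and>
      (0 < a \<or> 0 < b \<or> 0 < c \<longrightarrow> b div 2 \<noteq> f (c div 2) (a div 2))"
    show "b = f c a"
    proof (rule ccontr)
      assume ne: "b \<noteq> f c a"
      then have b: "b < f c a" using * linorder_neqE_nat[OF ne] by blast
      have a: "a < f c b"
        using * ne involution[OF less.prems] by (metis linorder_neqE_nat)
      have stuck: "(\<exists>k<c. f k a = b) \<or> f (c div 2) (a div 2) = b div 2"
      proof (cases "a \<le> b")
        case True
        then show ?thesis using mex[OF less.prems] a b by blast
      next
        case False
        \<comment> \<open>With the first two piles exchanged \<open>mex\<close> applies; the
          involutions for \<open>c div 2\<close> and for each \<open>k < c\<close> carry its answer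
          back.\<close>
        then have "(\<exists>k<c. f k b = a) \<or> f (c div 2) (b div 2) = a div 2"
          using mex[OF less.prems, of b a] a b by simp
        then show ?thesis
          using involution[OF c2] involution less.prems by (metis less_trans)
      qed
      \<comment> \<open>If all piles were empty, \<open>stuck\<close> would reduce to
        \<open>f 0 0 = 0\<close>, against \<open>b < f c a\<close>.\<close>
      then have "0 < a \<or> 0 < b \<or> 0 < c"
        using b by auto
      with stuck show False using * by metis
    qed
  qed
  finally show ?case .
qed


section \<open>The bijections pairing piles in P-positions\<close>

text \<open>Row 9 is the given table. The other rows are auxiliary: moves from a third pile of 9
  lead to smaller third piles, whose P-positions must be known as well.\<close>

definition head :: "nat list list" where
  "head =
    [
     [0,2,1,3,4,5,8,9,6,7,12,13,10,11,14,15,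
      16,17,18,19,20,21,22,23,24,25,26,27,30,31,28,29,
      34,35,32,33,38,39,36,37,42,43,40,41,46,47,44,45,
      50,51,48,49,54,55,52,53,56,57,58,59,60,61,62,63],
     [2,3,0,1,5,4,9,8,7,6,13,12,11,10,15,14,
      17,16,19,18,21,20,23,22,25,24,27,26,31,30,29,28,
      35,34,33,32,39,38,37,36,43,42,41,40,47,46,45,44,
      51,50,49,48,55,54,53,52,57,56,59,58,61,60,63,62],
     [1,0,2,4,3,6,5,7,8,9,10,11,12,13,18,19,
      20,21,14,15,16,17,26,27,28,29,22,23,24,25,30,31,
      32,33,34,35,36,37,38,39,40,41,42,43,44,45,46,47,
      48,49,50,51,52,53,54,55,58,59,56,57,62,63,60,61],
     [3,1,4,0,2,7,6,5,9,8,11,10,13,12,19,18,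
      21,20,15,14,17,16,27,26,29,28,23,22,25,24,31,30,
      33,32,35,34,37,36,39,38,41,40,43,42,45,44,47,46,
      49,48,51,50,53,52,55,54,59,58,57,56,63,62,61,60],
     [4,5,3,2,0,1,7,6,10,11,8,9,14,15,12,13,
      18,19,16,17,22,23,20,21,26,27,24,25,28,29,32,33,
      30,31,36,37,34,35,40,41,38,39,44,45,42,43,48,49,
      46,47,52,53,50,51,56,57,54,55,60,61,58,59,64,65],
     [5,4,6,7,1,0,2,3,11,10,9,8,15,14,13,12,
      19,18,17,16,23,22,21,20,27,26,25,24,29,28,33,32,
      31,30,37,36,35,34,41,40,39,38,45,44,43,42,49,48,
      47,46,53,52,51,50,57,56,55,54,61,60,59,58,65,64],
     [8,9,5,6,7,2,3,4,0,1,16,17,18,19,20,21,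
      10,11,12,13,14,15,24,25,22,23,28,29,26,27,34,35,
      36,37,30,31,32,33,42,43,44,45,38,39,40,41,50,51,
      52,53,46,47,48,49,58,59,60,61,54,55,56,57,66,67],
     [9,8,7,5,6,3,4,2,1,0,17,16,19,18,21,20,
      11,10,13,12,15,14,25,24,23,22,29,28,27,26,35,34,
      37,36,31,30,33,32,43,42,45,44,39,38,41,40,51,50,
      53,52,47,46,49,48,59,58,61,60,55,54,57,56,67,66],
     [6,7,8,9,10,11,0,1,2,3,4,5,16,17,22,23,
      12,13,20,21,18,19,14,15,30,31,32,33,34,35,24,25,
      26,27,28,29,40,41,44,45,36,37,48,49,38,39,52,53,
      42,43,56,57,46,47,60,61,50,51,62,63,54,55,58,59],
     phi9_table]"

text \<open>
  Displacements, increased by 9 to stay in \<^typ>\<open>nat\<close>. The argument \<open>e\<close> stands for the parity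
  computed by \<open>level\<close> below.
\<close>

definition offsets :: "bool \<Rightarrow> nat list list" where
  "offsets e =
    [if e then [9] else [11,11,7,7],
     if e then [10,8] else [12,10,8,6],
     if e then [11,11,7,7] else [9],
     if e then [12,10,8,6] else [10,8],
     [7,7,11,11],
     [8,6,12,10],
     [13,13,5,5,5,5,13,13],
     [14,12,6,4,6,4,14,12],
     [3,3,3,3,15,15,15,15,15,15,3,3],
     [4,2,4,2,16,14,16,14,16,14,4,2]]"

definition pair :: "bool \<Rightarrow> nat \<Rightarrow> nat \<Rightarrow> nat" where
  "pair e c x =
    (if x < 64 then head ! c ! x
     else x + (let d = offsets e ! c in d ! (x mod length d)) - 9)"

text \<open>Equalities of lists, each of which splits into 64 pointwise equations valid for both
  parities.\<close>

lemma upt_pair_head: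
  "map (pair e 0) [0..<64] = head ! 0"
  "map (pair e 1) [0..<64] = head ! 1"
  "map (pair e 2) [0..<64] = head ! 2"
  "map (pair e 3) [0..<64] = head ! 3"
  "map (pair e 4) [0..<64] = head ! 4"
  "map (pair e 5) [0..<64] = head ! 5"
  "map (pair e 6) [0..<64] = head ! 6"
  "map (pair e 7) [0..<64] = head ! 7"
  "map (pair e 8) [0..<64] = head ! 8"
  "map (pair e 9) [0..<64] = head ! 9"
  by (rule nth_equalityI; simp add: pair_def; simp add: head_def phi9_table_def)+

lemmas numeral_upt = upt_conv_Cons numeral_2_eq_2[symmetric]

text \<open>One rewrite rule per table entry, so that the checks below never unfold the tables.\<close>

lemmas pair_head =
  upt_pair_head[unfolded head_def phi9_table_def, simplified numeral_upt, simplified]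

lemma pair_tail:
  assumes "64 \<le> x"
  shows "pair False 0 x = x + [11,11,7,7] ! (x mod 4) - 9"
    "pair True 0 x = x"
    "pair False (Suc 0) x = x + [12,10,8,6] ! (x mod 4) - 9"
    "pair True (Suc 0) x = x + [10,8] ! (x mod 2) - 9"
    "pair False 2 x = x"
    "pair True 2 x = x + [11,11,7,7] ! (x mod 4) - 9"
    "pair False 3 x = x + [10,8] ! (x mod 2) - 9"
    "pair True 3 x = x + [12,10,8,6] ! (x mod 4) - 9"
    "pair e 4 x = x + [7,7,11,11] ! (x mod 4) - 9"
    "pair e 5 x = x + [8,6,12,10] ! (x mod 4) - 9"
    "pair e 6 x = x + [13,13,5,5,5,5,13,13] ! (x mod 8) - 9"
    "pair e 7 x = x + [14,12,6,4,6,4,14,12] ! (x mod 8) - 9"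
    "pair e 8 x = x + [3,3,3,3,15,15,15,15,15,15,3,3] ! (x mod 12) - 9"
    "pair e 9 x = x + [4,2,4,2,16,14,16,14,16,14,4,2] ! (x mod 12) - 9"
  using assms by (simp_all add: pair_def offsets_def numeral_2_eq_2[symmetric])

lemma less_10_cases:
  assumes "c < (10::nat)"
  obtains "c = 0" | "c = 1" | "c = 2" | "c = 3" | "c = 4"
    | "c = 5" | "c = 6" | "c = 7" | "c = 8" | "c = 9"
proof -
  have "c \<in> {0, 1, 2, 3, 4, 5, 6, 7, 8, 9}" using assms by auto
  then show thesis using that by blast
qed

lemma pair_add_24:
  assumes "64 \<le> x" "c < 10"
  shows "pair e c (x + 24 * k) = pair e c x + 24 * k"
proof -
  have "length (offsets e ! c) \<in> {1, 2, 4, 8, 12}"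
    by (rule less_10_cases[OF assms(2)]) (simp_all add: offsets_def)
  then have "length (offsets e ! c) dvd 24" by auto
  then have "(x + 24 * k) mod length (offsets e ! c) = x mod length (offsets e ! c)"
    by (metis dvd_mult2 mod_add_right_eq dvd_imp_mod_0 add.right_neutral)
  then show ?thesis using assms(1) by (simp add: pair_def Let_def)
qed

lemma pair_level_irrelevant:
  assumes "x < 64 \<or> 4 \<le> c \<and> c < 10"
  shows "pair e c x = pair e' c x"
proof -
  have "offsets e ! c = offsets e' ! c" if "4 \<le> c" "c < 10"
    by (rule less_10_cases[OF that(2)]) (use that in \<open>auto simp: offsets_def\<close>)
  then show ?thesis using assms by (auto simp: pair_def)
qed

section \<open>The finite check\<close>

text \<open>With \<open>y\<close>, \<open>h\<close>, \<open>ys\<close> as supplied by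
  \<open>consistent\<close>, the first three clauses and the last mirror \<open>involution\<close>,
  \<open>distinct\<close>, \<open>halve\<close> and \<open>mex\<close> at a single
  \<open>a\<close>.\<close>

definition consistent_values ::
    "bool \<Rightarrow> nat \<Rightarrow> nat \<Rightarrow> nat \<Rightarrow> nat \<Rightarrow> nat list \<Rightarrow> bool" where
  "consistent_values e a c y h ys \<longleftrightarrow>
    pair e c y = a \<and>
    list_all (\<lambda>z. z \<noteq> y) ys \<and>
    (0 < a \<or> 0 < y \<or> 0 < c \<longrightarrow> h \<noteq> y div 2) \<and>
    (c < 4 \<longrightarrow> (if a < 64 then y < 64 else y div 8 = a div 8)) \<and>
    (128 \<le> a \<longrightarrow> 64 \<le> y) \<and>
    list_all (\<lambda>b. h = b div 2 \<or> list_ex (\<lambda>z. z = b) ys \<or> pair e c b \<le> a) [a..<y]"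

text \<open>
  Passing the values as arguments lets the simplifier evaluate each of them only once. The
  conditions for \<open>c < 4\<close> and \<open>128 \<le> a\<close> keep \<open>y\<close> where the parity is that of \<open>a\<close> and where
  periodicity holds, respectively.
\<close>

definition consistent :: "bool \<Rightarrow> nat \<Rightarrow> nat \<Rightarrow> bool" where
  "consistent e a c \<longleftrightarrow>
    consistent_values e a c (pair e c a) (pair (\<not> e) (c div 2) (a div 2))
      (map (\<lambda>k. pair e k a) [0..<c])"

lemma consistent_iff:
  "consistent e a c \<longleftrightarrow>
    pair e c (pair e c a) = a \<and>
    (\<forall>k<c. pair e k a \<noteq> pair e c a) \<and>
    (0 < a \<or> 0 < pair e c a \<or> 0 < c \<longrightarrow> pair (\<not> e) (c div 2) (a div 2) \<noteq> pair e c a div 2) \<and>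
    (c < 4 \<longrightarrow> (if a < 64 then pair e c a < 64 else pair e c a div 8 = a div 8)) \<and>
    (128 \<le> a \<longrightarrow> 64 \<le> pair e c a) \<and>
    (\<forall>b\<in>{a..<pair e c a}.
      pair (\<not> e) (c div 2) (a div 2) = b div 2 \<or> (\<exists>k<c. pair e k a = b) \<or> pair e c b \<le> a)"
proof -
  have "list_all (\<lambda>z. z \<noteq> y) (map f [0..<c]) \<longleftrightarrow> (\<forall>k<c. f k \<noteq> y)" for f and y :: nat
    by (auto simp: list_all_iff)
  moreover have "list_ex (\<lambda>z. z = b) (map f [0..<c]) \<longleftrightarrow> (\<exists>k<c. f k = b)" for f and b :: nat
    by (auto simp: list_ex_iff)
  moreover have "list_all Q [i..<j] \<longleftrightarrow> (\<forall>b\<in>{i..<j}. Q b)" for Q i j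
    by (simp add: list_all_iff)
  ultimately show ?thesis
    unfolding consistent_def consistent_values_def by simp
qed

lemmas consistent_simps =
  numeral_upt consistent_def consistent_values_def pair_head pair_tail

text \<open>The ranges are cut at 56 and 112, where \<open>level\<close> changes, at 64, where the
  tables end, and at 128, from where \<open>a div 2\<close> is beyond the tables too. The range from
  128 to 175 is one period of 48 and is checked for both parities.\<close>

lemma consistent_below_56:
  "list_all (\<lambda>a. list_all (consistent e a) [0..<10]) [0..<56]"
  by (simp add: consistent_simps)

lemma consistent_below_64:
  "list_all (\<lambda>a. list_all (consistent True a) [0..<10]) [56..<64]"
  by (simp add: consistent_simps)

lemma consistent_below_112:
  "list_all (\<lambda>a. list_all (consistent True a) [0..<10]) [64..<112]"
  by (simp add: consistent_simps)

lemma consistent_below_128: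
  "list_all (\<lambda>a. list_all (consistent False a) [0..<10]) [112..<128]"
  by (simp add: consistent_simps)

lemma consistent_below_176_True:
  "list_all (\<lambda>a. list_all (consistent True a) [0..<10]) [128..<176]"
  by (simp add: consistent_simps)

lemma consistent_below_176_False:
  "list_all (\<lambda>a. list_all (consistent False a) [0..<10]) [128..<176]"
  by (simp add: consistent_simps)

section \<open>Periodicity\<close>

lemma list_all_uptD: "list_all Q [i..<j] \<Longrightarrow> i \<le> x \<Longrightarrow> x < j \<Longrightarrow> Q x"
  by (simp add: list_all_iff)

text \<open>For \<open>128 \<le> a\<close> every argument of \<open>pair\<close> that occurs,
  including \<open>a div 2\<close> and the partner of \<open>a\<close>, is at least 64, so
  \<open>pair_add_24\<close> shifts all values along.\<close>

lemma consistent_add_48: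
  assumes "consistent e a c" "128 \<le> a" "c < 10"
  shows "consistent e (a + 48 * k) c"
proof -
  define y h where "y = pair e c a" and "h = pair (\<not> e) (c div 2) (a div 2)"
  have y: "64 \<le> y" using assms by (simp add: consistent_iff y_def)
  have shift: "pair e' c' (x + 48 * k) = pair e' c' x + 48 * k" if "64 \<le> x" "c' < 10" for e' c' x
    using pair_add_24[OF that, of e' "2 * k"] by simp
  have a': "pair e c (a + 48 * k) = y + 48 * k"
    using shift[of a c e] assms by (simp add: y_def)
  have y': "pair e c (y + 48 * k) = pair e c y + 48 * k"
    using shift[of y c e] y assms(3) by simp
  have col: "pair e k' (a + 48 * k) = pair e k' a + 48 * k" if "k' < c" for k'
    using shift[of a k' e] assms that by simp
  have div8: "(z + 48 * k) div 8 = z div 8 + 6 * k" for z :: nat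
    using div_mult_self1[of 8 z "6 * k"] by simp
  have div2: "(z + 48 * k) div 2 = z div 2 + 24 * k" for z :: nat
    using div_mult_self1[of 2 z "24 * k"] by simp
  have h': "pair (\<not> e) (c div 2) ((a + 48 * k) div 2) = h + 24 * k"
  proof -
    have "64 \<le> a div 2" "c div 2 < 10" using assms(2,3) by linarith+
    then show ?thesis unfolding div2 h_def by (rule pair_add_24)
  qed
  have win: "h + 24 * k = b div 2 \<or> (\<exists>k'<c. pair e k' (a + 48 * k) = b) \<or> pair e c b \<le> a + 48 * k"
    if b: "b \<in> {a + 48 * k..<y + 48 * k}" for b
  proof -
    define b' where "b' = b - 48 * k"
    have b': "b = b' + 48 * k" "b' \<in> {a..<y}" using b by (auto simp: b'_def)
    then have "h = b' div 2 \<or> (\<exists>k'<c. pair e k' a = b') \<or> pair e c b' \<le> a"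
      using assms(1) by (simp add: consistent_iff y_def h_def)
    moreover have "pair e c b = pair e c b' + 48 * k"
      using shift[of b' c e] b' assms by simp
    ultimately show ?thesis using b' by (auto simp: div2 col)
  qed
  show ?thesis
    unfolding consistent_iff a' h'
    using assms(1,2) y win col
    by (auto simp: consistent_iff y' div8 div2 simp flip: y_def h_def)
qed

text \<open>For \<open>28 \<le> x\<close>: the \<open>k\<close> with \<open>7 * 2 ^ k \<le> x < 7 * 2 ^ (k + 1)\<close> is odd.\<close>

fun level :: "nat \<Rightarrow> bool" where
  "level x = (if 56 \<le> x then \<not> level (x div 2) else False)"

declare level.simps [simp del]

text \<open>The points 56, 112, 224, ... where \<open>level\<close> changes are all multiples of
  8.\<close>

lemma level_cong: "a div 8 = b div 8 \<Longrightarrow> level a = level b"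
proof (induction a arbitrary: b rule: less_induct)
  case (less a)
  have "x div 2 div 8 = x div 8 div 2" for x :: nat
    by (simp flip: div_mult2_eq)
  then have "a div 2 div 8 = b div 2 div 8" using less.prems by metis
  then have "level (a div 2) = level (b div 2)" if "56 \<le> a"
    using less.IH[of "a div 2"] that by simp
  moreover have "56 \<le> x \<longleftrightarrow> 7 \<le> x div 8" for x :: nat by presburger
  then have "56 \<le> a \<longleftrightarrow> 56 \<le> b" using less.prems by metis
  ultimately show ?case
    by (simp add: level.simps[of a] level.simps[of b])
qed

lemma level_below_128:
  assumes "56 \<le> x" "x < 128"
  shows "level x \<longleftrightarrow> x < 112"
proof -
  have "level x \<longleftrightarrow> \<not> level (x div 2)" using assms by (simp add: level.simps[of x])
  moreover have "level (x div 2) \<longleftrightarrow> 56 \<le> x div 2"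
    using assms by (simp add: level.simps[of "x div 2"] level.simps[of "x div 2 div 2"])
  ultimately show ?thesis by linarith
qed

lemma consistent_level:
  assumes "c < 10"
  shows "consistent (level a) a c"
proof -
  have list_allD: "consistent e a c"
    if "list_all (\<lambda>a. list_all (consistent e a) [0..<10]) [i..<j]" "i \<le> a" "a < j" for e i j a
    using list_all_uptD[OF list_all_uptD[OF that]] assms by blast
  consider "a < 56" | "56 \<le> a" "a < 64" | "64 \<le> a" "a < 112" | "112 \<le> a" "a < 128" | "128 \<le> a"
    by linarith
  then show ?thesis
  proof cases
    case 1
    then show ?thesis using list_allD[OF consistent_below_56] by simp
  next
    case 2
    then show ?thesis using list_allD[OF consistent_below_64] by (simp add: level_below_128)
  next
    case 3
    then show ?thesis using list_allD[OF consistent_below_112] by (simp add: level_below_128)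
  next
    case 4
    then show ?thesis using list_allD[OF consistent_below_128] by (simp add: level_below_128)
  next
    case 5
    \<comment> \<open>The parities \<open>level r\<close> and \<open>level a\<close> may differ,
      which is why \<open>r\<close> is consistent for both.\<close>
    define r where "r = 128 + (a - 128) mod 48"
    have r: "128 \<le> r" "r < 176" by (simp_all add: r_def)
    have "consistent e r c" for e
      using list_allD[OF consistent_below_176_True r] list_allD[OF consistent_below_176_False r]
      by (cases e) auto
    moreover have "a = r + 48 * ((a - 128) div 48)"
      using 5 unfolding r_def by (metis add.assoc le_add_diff_inverse mod_mult_div_eq)
    ultimately show ?thesis
      using consistent_add_48[OF _ r(1) assms] by metis
  qed
qed

definition phi :: "nat \<Rightarrow> nat \<Rightarrow> nat" where
  "phi c x = pair (level x) c x"

text \<open>Consistency at \<open>a\<close> evaluates other points \<open>b\<close> with the parity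
  of \<open>a\<close>. For \<open>c < 4\<close> such a \<open>b\<close> is below 64 or in the same
  block of 8 as \<open>a\<close>; for larger \<open>c\<close> parity has no effect.\<close>

lemma phi_eq_pair_level:
  assumes "c < 10" "b = phi c a \<or> b \<in> {a..<phi c a}"
  shows "phi c b = pair (level a) c b"
proof (cases "c < 4")
  case True
  then have *: "if a < 64 then phi c a < 64 else phi c a div 8 = a div 8"
    using consistent_level[OF assms(1), of a] by (simp add: consistent_iff phi_def)
  show ?thesis
  proof (cases "a < 64")
    case True
    then have "b < 64" using * assms(2) by auto
    then show ?thesis unfolding phi_def by (intro pair_level_irrelevant) simp
  next
    case False
    then have "phi c a div 8 = a div 8" using * by simp
    then have "b div 8 = a div 8"
      using assms(2) div_le_mono[of a b 8] div_le_mono[of b "phi c a" 8] by auto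
    then show ?thesis unfolding phi_def by (simp add: level_cong[of b a])
  qed
next
  case False
  then show ?thesis
    unfolding phi_def using assms(1) by (intro pair_level_irrelevant) simp
qed

text \<open>Below 128 the half is looked up in a table, whatever the parity; from 128 on
  \<open>level\<close> flips under halving.\<close>

lemma phi_half:
  "pair (\<not> level a) (c div 2) (a div 2) = phi (c div 2) (a div 2)"
proof (cases "a < 128")
  case True
  then have "a div 2 < 64" by linarith
  then show ?thesis unfolding phi_def by (intro pair_level_irrelevant) simp
next
  case False
  then show ?thesis by (simp add: phi_def level.simps[of a])
qed

lemma P_position_iff_phi:
  assumes "c < 10"
  shows "P_position {#a, b, c#} \<longleftrightarrow> b = phi c a"
proof (rule P_position_three_piles_iff[OF _ _ _ _ assms])
  fix c a b :: nat
  assume c: "c < 10"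
  note consistent = consistent_level[OF c, of a, unfolded consistent_iff phi_half, folded phi_def]
  show "phi c (phi c a) = a"
    using consistent phi_eq_pair_level[OF c, of "phi c a" a] by simp
  show "phi k a \<noteq> phi c a" if "k < c" for k
    using consistent that by (simp add: phi_def)
  show "phi (c div 2) (a div 2) \<noteq> phi c a div 2" if "0 < a \<or> 0 < phi c a \<or> 0 < c"
    using consistent that by blast
  show "(\<exists>k<c. phi k a = b) \<or> phi (c div 2) (a div 2) = b div 2"
    if "a \<le> b" "b < phi c a" "a < phi c b"
    using consistent that phi_eq_pair_level[OF c, of b a] by (auto simp: phi_def)
qed

section \<open>The given closed form\<close>

text \<open>XOR with 7 acts on the three lowest bits only.\<close>

lemma xor_7_add_mult_8: "xor (z + 8 * k) 7 = xor z 7 + 8 * (k :: int)"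
proof -
  have decomp: "xor y 7 = 8 * (y div 8) + xor (y mod 8) 7" for y :: int
  proof -
    have "drop_bit 3 (xor y 7) = drop_bit 3 y"
      by (simp add: drop_bit_xor)
    moreover have "take_bit 3 (xor y 7) = xor (take_bit 3 y) 7"
      by (simp add: take_bit_xor)
    ultimately show ?thesis
      using bits_ident[of 3 "xor y 7"]
      by (simp add: drop_bit_eq_div take_bit_eq_mod push_bit_eq_mult)
  qed
  show ?thesis
    by (simp add: decomp[of z] decomp[of "z + 8 * k"])
qed

lemma phi9_add_24:
  assumes "64 \<le> x"
  shows "phi9 (x + 24 * k) = phi9 x + 24 * k"
proof -
  have "(x + 24 * k - 64) mod 24 = (x - 64) mod 24"
    using assms by (metis Nat.add_diff_assoc2 mod_mult_self2)
  then have "int (phi9 (x + 24 * k)) = int (phi9 x + 24 * k)"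
    using assms xor_7_add_mult_8[of "int x + int (S9 ! ((x - 64) mod 24))" "3 * int k"]
    by (simp add: int_phi9 shifted_xor_def algebra_simps)
  then show ?thesis by linarith
qed

text \<open>One full period of 24 suffices, as both sides commute with adding 24 from 64 on.\<close>

lemma phi9_eq_pair_below_88:
  "list_all (\<lambda>x. phi9 x = pair e 9 x) [64..<88]"
  by (simp add: upt_conv_Cons phi9_def S9_def shifted_xor_def pair_tail)

lemma phi9_eq_phi: "phi9 x = phi 9 x"
proof (cases "x < 64")
  case True
  then show ?thesis by (simp add: phi9_def phi_def pair_def head_def)
next
  case False
  define r where "r = 64 + (x - 64) mod 24"
  have r: "64 \<le> r" "r < 88" by (simp_all add: r_def)
  obtain k where x: "x = r + 24 * k"
  proof
    show "x = r + 24 * ((x - 64) div 24)"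
      using False unfolding r_def
      by (metis add.assoc le_add_diff_inverse linorder_not_less mod_mult_div_eq)
  qed
  have "phi9 r = pair (level x) 9 r"
    using list_all_uptD[OF phi9_eq_pair_below_88 r] .
  then have "phi9 x = pair (level x) 9 x"
    using phi9_add_24[OF r(1), of k] pair_add_24[OF r(1), of 9 "level x" k] by (simp flip: x)
  then show ?thesis by (simp add: phi_def)
qed

theorem theorem40:
  fixes a b :: nat
  shows "P_position {#a, b, 9#} \<longleftrightarrow> b = phi9 a"
  by (simp add: P_position_iff_phi phi9_eq_phi)

end
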